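(* Suppose that the self-adjoint, compact operator $T:U\to U$ has the representation $T=\sum_{i\in\mathbb{N}}\lambda_i\,u_i\otimes u_i$. Renumber the eigenfunctions $\{u_i\}_{i\in\mathbb{N}}$ as $\{\psi_{j,k}\}_{j\in\mathbb{N}_0,\,k\in\Gamma_j^\psi}$ by $\Gamma_j^\psi:=\{0,1,\dots,2^j-1\}$ and $\psi_{j,k}:=u_{2^j+k}$. If the eigenvalues satisfy $\lambda_{2^j}\approx 2^{-2j}$, then, for $r>0$, $A^{r,2}_\lambda(U)\approx A^{r,2}(U)$.
   Context: $U$ is a real separable Hilbert space, $(u\otimes v)f:=u\,(v,f)_U$; $\lambda_1\ge\lambda_2\ge\dots>0$ are the eigenvalues of $T$ in nonincreasing order (with multiplicity) and $\{u_i\}_{i\in\mathbb{N}}$ is an orthonormal basis of $U$ of corresponding eigenfunctions. The spaces are $$A^{r,2}_\lambda(U):=\Big\{f\in U\;\Big|\;|f|^2_{A^{r,2}_\lambda(U)}:=\sum_{i\in\mathbb{N}}\lambda_i^{-r}|(f,u_i)_U|^2<\infty\Big\},$$ $$A^{r,2}(U):=\Big\{f\in U\;\Big|\;|f|^2_{A^{r,2}(U)}:=\sum_{j\in\mathbb{N}_0}2^{2rj}\sum_{k\in\Gamma_j^\psi}|(f,\psi_{j,k})_U|^2<\infty\Big\}.$$ For sequences, $a_j\approx b_j$ means there are constants $c_1,c_2>0$ independent of $j$ with $c_1a_j\le b_j\le c_2a_j$. For spaces, $\approx$ means that they coincide as sets and their seminorms are equivalent up to positive multiplicative constants. *)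

theory Defs
  imports "HOL-Analysis.Analysis"
begin

definition compact_operator :: "('a::real_normed_vector \<Rightarrow> 'b::real_normed_vector) \<Rightarrow> bool" where
  "compact_operator T \<longleftrightarrow> bounded_linear T \<and> compact (closure (T ` cball 0 1))"

definition self_adjoint :: "('a::real_inner \<Rightarrow> 'a) \<Rightarrow> bool" where
  "self_adjoint T \<longleftrightarrow> bounded_linear T \<and> (\<forall>f g. inner (T f) g = inner f (T g))"

definition orthonormal_basis :: "'i set \<Rightarrow> ('i \<Rightarrow> 'a::real_inner) \<Rightarrow> bool" where
  "orthonormal_basis I u \<longleftrightarrow>
     (\<forall>i\<in>I. \<forall>j\<in>I. inner (u i) (u j) = (if i = j then 1 else 0)) \<and> closure (span (u ` I)) = UNIV"

definition tensor :: "'a::real_inner \<Rightarrow> 'a \<Rightarrow> 'a \<Rightarrow> 'a" where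
  "tensor u v f = inner v f *\<^sub>R u"

(* The sum of operators converges pointwise. For compact T this is equivalent to
   convergence in operator norm. *)
definition spectral_representation ::
  "('a::real_inner \<Rightarrow> 'a) \<Rightarrow> 'i set \<Rightarrow> ('i \<Rightarrow> real) \<Rightarrow> ('i \<Rightarrow> 'a) \<Rightarrow> bool" where
  "spectral_representation T I lam u \<longleftrightarrow>
     (\<forall>f. ((\<lambda>i. lam i *\<^sub>R tensor (u i) (u i) f) has_sum T f) I)"

(* The squared seminorms are [0,\<infinity>]-valued, so that they make sense for every f in U;
   the spaces consist of the f where they are finite, and the real-valued seminorms
   are meaningful on these spaces only. *)

definition Alam_sq :: "'i set \<Rightarrow> ('i \<Rightarrow> real) \<Rightarrow> ('i \<Rightarrow> 'a::real_inner) \<Rightarrow> real \<Rightarrow> 'a \<Rightarrow> ennreal" where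
  "Alam_sq I lam u r f = (\<Sum>\<^sub>\<infinity>i\<in>I. ennreal (lam i powr (- r) * \<bar>inner f (u i)\<bar>\<^sup>2))"

definition Alam :: "'i set \<Rightarrow> ('i \<Rightarrow> real) \<Rightarrow> ('i \<Rightarrow> 'a::real_inner) \<Rightarrow> real \<Rightarrow> 'a set" where
  "Alam I lam u r = {f. Alam_sq I lam u r f < \<infinity>}"

definition Alam_seminorm :: "'i set \<Rightarrow> ('i \<Rightarrow> real) \<Rightarrow> ('i \<Rightarrow> 'a::real_inner) \<Rightarrow> real \<Rightarrow> 'a \<Rightarrow> real" where
  "Alam_seminorm I lam u r f = sqrt (enn2real (Alam_sq I lam u r f))"

definition A_sq :: "(nat \<Rightarrow> 'k set) \<Rightarrow> (nat \<Rightarrow> 'k \<Rightarrow> 'a::real_inner) \<Rightarrow> real \<Rightarrow> 'a \<Rightarrow> ennreal" where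
  "A_sq \<Gamma> \<psi> r f =
     (\<Sum>\<^sub>\<infinity>j\<in>UNIV. ennreal (2 powr (2 * r * real j)) *
        (\<Sum>\<^sub>\<infinity>k\<in>\<Gamma> j. ennreal (\<bar>inner f (\<psi> j k)\<bar>\<^sup>2)))"

definition A_space :: "(nat \<Rightarrow> 'k set) \<Rightarrow> (nat \<Rightarrow> 'k \<Rightarrow> 'a::real_inner) \<Rightarrow> real \<Rightarrow> 'a set" where
  "A_space \<Gamma> \<psi> r = {f. A_sq \<Gamma> \<psi> r f < \<infinity>}"

definition A_seminorm :: "(nat \<Rightarrow> 'k set) \<Rightarrow> (nat \<Rightarrow> 'k \<Rightarrow> 'a::real_inner) \<Rightarrow> real \<Rightarrow> 'a \<Rightarrow> real" where
  "A_seminorm \<Gamma> \<psi> r f = sqrt (enn2real (A_sq \<Gamma> \<psi> r f))"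

definition dyadic_index :: "nat \<Rightarrow> nat set" where
  "dyadic_index j = {0..2 ^ j - 1}"

definition dyadic_renumber :: "(nat \<Rightarrow> 'a) \<Rightarrow> nat \<Rightarrow> nat \<Rightarrow> 'a" where
  "dyadic_renumber u j k = u (2 ^ j + k)"

definition seq_equiv :: "(nat \<Rightarrow> real) \<Rightarrow> (nat \<Rightarrow> real) \<Rightarrow> bool" where
  "seq_equiv a b \<longleftrightarrow> (\<exists>c1>0. \<exists>c2>0. \<forall>j. c1 * a j \<le> b j \<and> b j \<le> c2 * a j)"

definition space_equiv :: "'a set \<Rightarrow> ('a \<Rightarrow> real) \<Rightarrow> 'a set \<Rightarrow> ('a \<Rightarrow> real) \<Rightarrow> bool" where
  "space_equiv A p B q \<longleftrightarrow>
     A = B \<and> (\<exists>c1>0. \<exists>c2>0. \<forall>f\<in>A. c1 * p f \<le> q f \<and> q f \<le> c2 * p f)"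

end

theory Submission
  imports Defs
begin

text \<open>
  Both squared seminorms are weighted sums of the same numbers \<open>\<bar>(f, u\<^sub>i)\<bar>\<^sup>2\<close>. The blocks
  \<open>{2\<^sup>j, \<dots>, 2\<^sup>j\<^sup>+\<^sup>1 - 1}\<close> partition the positive integers, and all terms are
  nonnegative, so that the eigenvalue sum may be regrouped into blocks in \<open>[0,\<infinity>]\<close> without any
  question of convergence (\<open>bij_betw_dyadic_blocks\<close>, \<open>Alam_sq_dyadic\<close>). It remains to compare
  the weights \<open>\<lambda>\<^sub>i powr - r\<close> and \<open>2 powr (2 r j)\<close> for \<open>i\<close> in the block \<open>j\<close>: monotonicity
  squeezes \<open>\<lambda>\<^sub>i\<close> between the values of \<open>\<lambda>\<close> at the two consecutive powers of two, and these are
  comparable to \<open>2 powr (- 2 (j + 1))\<close> and \<open>2 powr (- 2 j)\<close>, which differ only by the factor 4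
  (\<open>dyadic_weight_bounds\<close>). Hence the squared seminorms are comparable for every \<open>f\<close>, with the
  value \<open>\<infinity>\<close> included, and this yields at once that the spaces coincide and that the seminorms are
  equivalent (\<open>space_equivI_sq\<close>).
\<close>

section \<open>Unordered sums in the extended nonnegative reals\<close>

lemma summable_on_ennreal_valued [simp]: "f summable_on A" for f :: "'b \<Rightarrow> ennreal"
  by (simp add: nonneg_summable_on_complete)

text \<open>The general law for unordered sums requires a topological semiring, which \<open>[0,\<infinity>]\<close> is not:
  multiplication is discontinuous at \<open>(0, \<infinity>)\<close>. Multiplication by one fixed finite number is
  continuous.\<close>

lemma infsum_cmult_ennreal:
  fixes f :: "'b \<Rightarrow> ennreal"
  shows "(\<Sum>\<^sub>\<infinity>x\<in>A. ennreal c * f x) = ennreal c * infsum f A"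
proof -
  have "continuous_on UNIV (\<lambda>x. ennreal c * x)"
    by (intro ennreal_continuous_on_cmult continuous_on_id) simp
  then have "isCont (\<lambda>x. ennreal c * x) (infsum f A)"
    by (simp add: continuous_on_eq_continuous_at)
  then have "infsum ((\<lambda>x. ennreal c * x) \<circ> f) A = ennreal c * infsum f A"
    by (intro infsum_comm_additive_general) (auto simp: sum_distrib_left)
  then show ?thesis
    by (simp add: o_def)
qed

lemma infsum_Sigma_ennreal_finite:
  fixes f :: "'b \<Rightarrow> 'c \<Rightarrow> ennreal"
  assumes "finite G"
  shows "(\<Sum>\<^sub>\<infinity>(x, y)\<in>Sigma G B. f x y) = (\<Sum>x\<in>G. \<Sum>\<^sub>\<infinity>y\<in>B x. f x y)"
  using assms
proof induction
  case empty
  show ?case by simp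
next
  case (insert x G)
  have "Sigma (insert x G) B = Pair x ` B x \<union> Sigma G B"
    by auto
  moreover have "Pair x ` B x \<inter> Sigma G B = {}"
    using insert.hyps by auto
  ultimately have "(\<Sum>\<^sub>\<infinity>(x, y)\<in>Sigma (insert x G) B. f x y)
      = (\<Sum>\<^sub>\<infinity>(x, y)\<in>Pair x ` B x. f x y) + (\<Sum>\<^sub>\<infinity>(x, y)\<in>Sigma G B. f x y)"
    by (simp only: infsum_Un_disjoint[OF summable_on_ennreal_valued summable_on_ennreal_valued])
  also have "(\<Sum>\<^sub>\<infinity>(x, y)\<in>Pair x ` B x. f x y) = (\<Sum>\<^sub>\<infinity>y\<in>B x. f x y)"
    by (subst infsum_reindex) (auto simp: inj_on_def o_def)
  finally show ?case
    using insert by simp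
qed

text \<open>Both sides are suprema of finite partial sums. A finite set of pairs meets only finitely many
  fibres, and conversely finitely many whole fibres form a part of \<open>Sigma A B\<close>, so that finite
  unions of fibres mediate between the two suprema.\<close>

lemma infsum_Sigma_ennreal:
  fixes f :: "'b \<Rightarrow> 'c \<Rightarrow> ennreal"
  shows "(\<Sum>\<^sub>\<infinity>(x, y)\<in>Sigma A B. f x y) = (\<Sum>\<^sub>\<infinity>x\<in>A. \<Sum>\<^sub>\<infinity>y\<in>B x. f x y)" (is "?L = ?R")
proof (rule antisym)
  have "sum (\<lambda>(x, y). f x y) F \<le> ?R" if F: "finite F" "F \<subseteq> Sigma A B" for F
  proof -
    have "sum (\<lambda>(x, y). f x y) F = infsum (\<lambda>(x, y). f x y) F"
      using F by simp
    also have "\<dots> \<le> (\<Sum>\<^sub>\<infinity>(x, y)\<in>Sigma (fst ` F) B. f x y)"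
      using F by (intro infsum_mono_neutral summable_on_ennreal_valued) force+
    also have "\<dots> = (\<Sum>\<^sub>\<infinity>x\<in>fst ` F. \<Sum>\<^sub>\<infinity>y\<in>B x. f x y)"
      using F by (simp add: infsum_Sigma_ennreal_finite)
    also have "\<dots> \<le> ?R"
      using F by (intro infsum_mono_neutral summable_on_ennreal_valued) force+
    finally show ?thesis .
  qed
  then show "?L \<le> ?R"
    by (rule infsum_le_finite_sums[OF summable_on_ennreal_valued])
  have "(\<Sum>x\<in>G. \<Sum>\<^sub>\<infinity>y\<in>B x. f x y) \<le> ?L" if G: "finite G" "G \<subseteq> A" for G
  proof -
    have "(\<Sum>\<^sub>\<infinity>(x, y)\<in>Sigma G B. f x y) \<le> ?L"
      using G by (intro infsum_mono_neutral summable_on_ennreal_valued) auto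
    then show ?thesis
      by (simp only: infsum_Sigma_ennreal_finite[OF G(1)])
  qed
  then show "?R \<le> ?L"
    by (rule infsum_le_finite_sums[OF summable_on_ennreal_valued])
qed

section \<open>Regrouping into dyadic blocks\<close>

lemma mem_dyadic_index: "k \<in> dyadic_index j \<longleftrightarrow> k < 2 ^ j"
proof -
  have "(0::nat) < 2 ^ j" by simp
  then show ?thesis unfolding dyadic_index_def by (simp only: atLeastAtMost_iff) linarith
qed

lemma bij_betw_dyadic_blocks:
  "bij_betw (\<lambda>(j, k). 2 ^ j + k) (Sigma UNIV dyadic_index) {1::nat..}"
proof (rule bij_betw_imageI)
  show "inj_on (\<lambda>(j, k). 2 ^ j + k) (Sigma UNIV dyadic_index)"
  proof (rule inj_onI, clarsimp simp: mem_dyadic_index)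
    fix j k j' k' :: nat
    assume k: "k < 2 ^ j" and k': "k' < 2 ^ j'" and eq: "2 ^ j + k = 2 ^ j' + k'"
    \<comment> \<open>The exponent is determined by the number, since \<open>2 ^ j \<le> i < 2 ^ Suc j\<close>.\<close>
    have "(2::nat) ^ j < 2 ^ Suc j'" "(2::nat) ^ j' < 2 ^ Suc j"
      using k k' eq by simp_all
    then have "j < Suc j'" "j' < Suc j"
      by (simp_all only: power_strict_increasing_iff one_less_numeral_iff semiring_norm)
    then have "j = j'"
      by simp
    then show "j = j' \<and> k = k'"
      using eq by simp
  qed
  show "(\<lambda>(j, k). 2 ^ j + k) ` Sigma UNIV dyadic_index = {1..}"
  proof
    show "(\<lambda>(j, k). 2 ^ j + k) ` Sigma UNIV dyadic_index \<subseteq> {1::nat..}"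
      by (clarsimp simp: Suc_le_eq)
    show "{1..} \<subseteq> (\<lambda>(j, k). 2 ^ j + k) ` Sigma UNIV dyadic_index"
    proof
      fix i :: nat
      assume "i \<in> {1..}"
      then obtain j where j: "2 ^ j \<le> i" "i < 2 ^ (j + 1)"
        using ex_power_ivl1[of 2 i] by auto
      then have "(j, i - 2 ^ j) \<in> Sigma UNIV dyadic_index" "i = 2 ^ j + (i - 2 ^ j)"
        by (auto simp: mem_dyadic_index)
      then show "i \<in> (\<lambda>(j, k). 2 ^ j + k) ` Sigma UNIV dyadic_index"
        by (metis (no_types, lifting) case_prod_conv image_eqI)
    qed
  qed
qed

lemma Alam_sq_dyadic:
  "Alam_sq {1..} lam u r f =
     (\<Sum>\<^sub>\<infinity>(j, k)\<in>Sigma UNIV dyadic_index.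
        ennreal (lam (2 ^ j + k) powr (- r) * \<bar>inner f (dyadic_renumber u j k)\<bar>\<^sup>2))"
  unfolding Alam_sq_def dyadic_renumber_def
    infsum_reindex_bij_betw[OF bij_betw_dyadic_blocks, symmetric]
  by (simp only: case_prod_beta')

lemma A_sq_Sigma:
  "A_sq \<Gamma> \<psi> r f =
     (\<Sum>\<^sub>\<infinity>(j, k)\<in>Sigma UNIV \<Gamma>. ennreal (2 powr (2 * r * real j) * \<bar>inner f (\<psi> j k)\<bar>\<^sup>2))"
  unfolding A_sq_def infsum_Sigma_ennreal infsum_cmult_ennreal[symmetric]
  by (simp only: ennreal_mult powr_ge_zero zero_le_power2)

section \<open>Comparison of the weights and of the seminorms\<close>

text \<open>In the block \<open>j\<close>, monotonicity gives \<open>lam (2 ^ (j + 1)) \<le> lam (2 ^ j + k) \<le> lam (2 ^ j)\<close>.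
  The upper weight bound uses the right end of the block, where the power of two has already
  dropped by the factor \<open>2 powr - 2\<close>; this is the origin of the 4.\<close>

lemma dyadic_weight_bounds:
  fixes lam :: "nat \<Rightarrow> real"
  assumes pos: "\<And>i. i \<ge> 1 \<Longrightarrow> lam i > 0"
    and mono: "\<And>i j. 1 \<le> i \<Longrightarrow> i \<le> j \<Longrightarrow> lam j \<le> lam i"
    and c: "c1 > 0" "c2 > 0"
    and low: "\<And>j. c1 * lam (2 ^ j) \<le> 2 powr (- 2 * real j)"
    and upp: "\<And>j. 2 powr (- 2 * real j) \<le> c2 * lam (2 ^ j)"
    and r: "r \<ge> 0" and k: "k < 2 ^ j"
  shows "c1 powr r * 2 powr (2 * r * real j) \<le> lam (2 ^ j + k) powr (- r)"
    and "lam (2 ^ j + k) powr (- r) \<le> (4 * c2) powr r * 2 powr (2 * r * real j)"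
proof -
  let ?l = "lam (2 ^ j + k)"
  have one: "1 \<le> (2::nat) ^ j" by simp
  have lpos: "?l > 0"
    using one by (intro pos) (rule trans_le_add1)
  have "c1 * ?l \<le> c1 * lam (2 ^ j)"
    using c one by (intro mult_left_mono mono) auto
  also have "\<dots> \<le> 2 powr (- 2 * real j)" by (rule low)
  finally have a: "c1 * ?l \<le> 2 powr (- 2 * real j)" .
  have "2 powr (- 2 * real j) = 4 * 2 powr (- 2 * real (Suc j))"
    using powr_add[of 2 2 "- 2 * real (Suc j)"] by simp
  also have "\<dots> \<le> 4 * (c2 * lam (2 ^ Suc j))"
    using upp[of "Suc j"] by simp
  also have "\<dots> \<le> 4 * (c2 * ?l)"
    using c k one by (intro mult_left_mono mono) (auto intro: trans_le_add1)
  finally have b: "2 powr (- 2 * real j) \<le> 4 * c2 * ?l" by simp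
  have e: "(2 powr (- 2 * real j)) powr r * 2 powr (2 * r * real j) = 1"
    by (simp add: powr_powr flip: powr_add)
  have inv: "?l powr r * ?l powr (- r) = 1"
    using lpos by (simp flip: powr_add)
  have "c1 powr r * ?l powr r \<le> (2 powr (- 2 * real j)) powr r"
    using powr_mono2[OF r _ a] c lpos by (simp add: powr_mult)
  then have "(c1 powr r * ?l powr r) * (?l powr (- r) * 2 powr (2 * r * real j))
      \<le> (2 powr (- 2 * real j)) powr r * (?l powr (- r) * 2 powr (2 * r * real j))"
    by (rule mult_right_mono) simp
  also have "\<dots> = ((2 powr (- 2 * real j)) powr r * 2 powr (2 * r * real j)) * ?l powr (- r)"
    by (simp only: mult_ac)
  also have "\<dots> = ?l powr (- r)"
    by (simp only: e mult_1)
  also have "(c1 powr r * ?l powr r) * (?l powr (- r) * 2 powr (2 * r * real j))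
      = (?l powr r * ?l powr (- r)) * (c1 powr r * 2 powr (2 * r * real j))"
    by (simp only: mult_ac)
  also have "\<dots> = c1 powr r * 2 powr (2 * r * real j)"
    by (simp only: inv mult_1)
  finally show "c1 powr r * 2 powr (2 * r * real j) \<le> ?l powr (- r)" .
  have "(2 powr (- 2 * real j)) powr r \<le> (4 * c2) powr r * ?l powr r"
    using powr_mono2[OF r _ b] c lpos by (simp add: powr_mult)
  then have "(2 powr (- 2 * real j)) powr r * (?l powr (- r) * 2 powr (2 * r * real j))
      \<le> ((4 * c2) powr r * ?l powr r) * (?l powr (- r) * 2 powr (2 * r * real j))"
    by (rule mult_right_mono) simp
  also have "\<dots> = (?l powr r * ?l powr (- r)) * ((4 * c2) powr r * 2 powr (2 * r * real j))"
    by (simp only: mult_ac)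
  also have "\<dots> = (4 * c2) powr r * 2 powr (2 * r * real j)"
    by (simp only: inv mult_1)
  also have "(2 powr (- 2 * real j)) powr r * (?l powr (- r) * 2 powr (2 * r * real j))
      = ((2 powr (- 2 * real j)) powr r * 2 powr (2 * r * real j)) * ?l powr (- r)"
    by (simp only: mult_ac)
  also have "\<dots> = ?l powr (- r)"
    by (simp only: e mult_1)
  finally show "?l powr (- r) \<le> (4 * c2) powr r * 2 powr (2 * r * real j)" .
qed

text \<open>Pointwise comparability in \<open>[0,\<infinity>]\<close> with finite positive constants transfers finiteness in
  both directions, so it encodes the equality of the spaces as well as that of the seminorms up
  to constants.\<close>

lemma space_equivI_sq:
  fixes P Q :: "'b \<Rightarrow> ennreal"
  assumes "a > 0" "b > 0"
    and low: "\<And>f. ennreal a * Q f \<le> P f" and upp: "\<And>f. P f \<le> ennreal b * Q f"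
  shows "space_equiv {f. P f < \<infinity>} (\<lambda>f. sqrt (enn2real (P f)))
           {f. Q f < \<infinity>} (\<lambda>f. sqrt (enn2real (Q f)))"
proof -
  have fin: "P f < \<infinity> \<longleftrightarrow> Q f < \<infinity>" for f
  proof
    assume "P f < \<infinity>"
    then have "ennreal a * Q f < \<infinity>"
      using low[of f] by (rule order.strict_trans1[rotated])
    then show "Q f < \<infinity>"
      using \<open>a > 0\<close> by (auto simp: ennreal_mult_less_top)
  next
    assume "Q f < \<infinity>"
    then have "ennreal b * Q f < \<infinity>"
      by (simp add: ennreal_mult_less_top)
    then show "P f < \<infinity>"
      using upp[of f] by (rule order.strict_trans1[rotated])
  qed
  have "1 / sqrt b * sqrt (enn2real (P f)) \<le> sqrt (enn2real (Q f)) \<and>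
      sqrt (enn2real (Q f)) \<le> 1 / sqrt a * sqrt (enn2real (P f))" if "P f < \<infinity>" for f
  proof -
    define p q where "p = enn2real (P f)" and "q = enn2real (Q f)"
    have pq: "P f = ennreal p" "Q f = ennreal q" "p \<ge> 0" "q \<ge> 0"
      using that fin[of f] by (simp_all add: p_def q_def)
    have "ennreal (a * q) \<le> ennreal p" "ennreal p \<le> ennreal (b * q)"
      using low[of f] upp[of f] pq \<open>a > 0\<close> \<open>b > 0\<close> by (simp_all add: ennreal_mult)
    then have "a * q \<le> p" "p \<le> b * q"
      using pq \<open>b > 0\<close> by (simp_all add: ennreal_le_iff)
    then have "sqrt (a * q) \<le> sqrt p" "sqrt p \<le> sqrt (b * q)"
      by (simp_all only: real_sqrt_le_mono)
    then show ?thesis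
      unfolding p_def[symmetric] q_def[symmetric]
      using \<open>a > 0\<close> \<open>b > 0\<close> by (simp add: real_sqrt_mult pos_le_divide_eq pos_divide_le_eq mult.commute)
  qed
  then show ?thesis
    unfolding space_equiv_def
    using fin \<open>a > 0\<close> \<open>b > 0\<close>
    by (intro conjI exI[of _ "1 / sqrt b"] exI[of _ "1 / sqrt a"]) auto
qed

section \<open>Equivalence of the approximation spaces\<close>

theorem theorem6p4:
  fixes T :: "'a::{real_inner, polish_space} \<Rightarrow> 'a"
    and lam :: "nat \<Rightarrow> real"
    and u :: "nat \<Rightarrow> 'a"
    and r :: real
  assumes "self_adjoint T"
    and "compact_operator T"
    and "\<And>i. i \<ge> 1 \<Longrightarrow> lam i > 0"
    and "\<And>i j. 1 \<le> i \<Longrightarrow> i \<le> j \<Longrightarrow> lam j \<le> lam i"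
    and "orthonormal_basis {1..} u"
    and "\<And>i. i \<ge> 1 \<Longrightarrow> T (u i) = lam i *\<^sub>R u i"
    and "spectral_representation T {1..} lam u"
    and "seq_equiv (\<lambda>j. lam (2 ^ j)) (\<lambda>j. 2 powr (- 2 * real j))"
    and "r > 0"
  shows "space_equiv
           (Alam {1..} lam u r) (Alam_seminorm {1..} lam u r)
           (A_space dyadic_index (dyadic_renumber u) r)
           (A_seminorm dyadic_index (dyadic_renumber u) r)"
proof -
  obtain c1 c2 where c: "c1 > 0" "c2 > 0"
    and low: "\<And>j. c1 * lam (2 ^ j) \<le> 2 powr (- 2 * real j)"
    and upp: "\<And>j. 2 powr (- 2 * real j) \<le> c2 * lam (2 ^ j)"
    using assms(8) unfolding seq_equiv_def by blast
  note weights = dyadic_weight_bounds[OF assms(3,4) c low upp less_imp_le[OF \<open>r > 0\<close>]]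
  let ?\<psi> = "dyadic_renumber u"
  have lower: "ennreal (c1 powr r) * A_sq dyadic_index ?\<psi> r f \<le> Alam_sq {1..} lam u r f" for f
    unfolding Alam_sq_dyadic A_sq_Sigma infsum_cmult_ennreal[symmetric]
  proof (intro infsum_mono summable_on_ennreal_valued, clarify)
    fix j k assume "k \<in> dyadic_index j"
    then have "(c1 powr r * 2 powr (2 * r * real j)) * \<bar>inner f (?\<psi> j k)\<bar>\<^sup>2
        \<le> lam (2 ^ j + k) powr (- r) * \<bar>inner f (?\<psi> j k)\<bar>\<^sup>2"
      by (intro mult_right_mono weights) (auto simp: mem_dyadic_index)
    then show "ennreal (c1 powr r) * ennreal (2 powr (2 * r * real j) * \<bar>inner f (?\<psi> j k)\<bar>\<^sup>2)
        \<le> ennreal (lam (2 ^ j + k) powr (- r) * \<bar>inner f (?\<psi> j k)\<bar>\<^sup>2)"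
      by (simp add: ennreal_leI mult.assoc flip: ennreal_mult)
  qed
  have upper: "Alam_sq {1..} lam u r f \<le> ennreal ((4 * c2) powr r) * A_sq dyadic_index ?\<psi> r f"
    for f
    unfolding Alam_sq_dyadic A_sq_Sigma infsum_cmult_ennreal[symmetric]
  proof (intro infsum_mono summable_on_ennreal_valued, clarify)
    fix j k assume "k \<in> dyadic_index j"
    then have "lam (2 ^ j + k) powr (- r) * \<bar>inner f (?\<psi> j k)\<bar>\<^sup>2
        \<le> ((4 * c2) powr r * 2 powr (2 * r * real j)) * \<bar>inner f (?\<psi> j k)\<bar>\<^sup>2"
      by (intro mult_right_mono weights) (auto simp: mem_dyadic_index)
    then show "ennreal (lam (2 ^ j + k) powr (- r) * \<bar>inner f (?\<psi> j k)\<bar>\<^sup>2)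
        \<le> ennreal ((4 * c2) powr r) * ennreal (2 powr (2 * r * real j) * \<bar>inner f (?\<psi> j k)\<bar>\<^sup>2)"
      by (simp add: ennreal_leI mult.assoc flip: ennreal_mult)
  qed
  show ?thesis
    using space_equivI_sq[OF _ _ lower upper] c
    by (simp add: Alam_def A_space_def Alam_seminorm_def[abs_def] A_seminorm_def[abs_def])
qed

end
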